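(* Let $R_w$ be the $5$-ary Boolean relation $R_w(x_1,x_2,x_3,x_4,c_0)\equiv(x_1\leftrightarrow x_2\wedge x_3)\wedge(x_2\vee x_3\to x_4)\wedge(c_0=0)$. Then $\langle R_w\rangle_{\exists!}\subsetneq\mathrm{IE}_0$.
   Context: $\mathrm{IE}_0=\mathrm{Inv}(\{\wedge,0\})$ is the set of Boolean relations preserved (under coordinatewise application) by binary conjunction $\wedge$ and by the constant operation $0$; it equals $\langle R_w\rangle$. A upp-definition of an $n$-ary relation $R$ over $\Gamma$ is a formula $R(x_1,\dots,x_n)\equiv\exists y_1,\dots,y_m\colon R_1(\mathbf{x}_1)\wedge\dots\wedge R_k(\mathbf{x}_k)$ with each $R_j\in\Gamma\cup\{\mathrm{Eq}\}$ (equality relation), $\mathbf{x}_j$ tuples of variables among $x_1,\dots,x_n,y_1,\dots,y_m$, such that each $y_j$ is uniquely determined by $x_1,\dots,x_n$ (a function of their values in every satisfying assignment of the conjunction). $\langle\Gamma\rangle_{\exists!}$ is the set of relations upp-definable over $\Gamma$. *)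

theory Defs
  imports Main
begin

text \<open>A Boolean relation carries its arity explicitly, so that empty relations of different
  arities are distinct; tuples are lists, with \<^term>\<open>False\<close> for 0 and \<^term>\<open>True\<close> for 1.\<close>

type_synonym brel = "nat \<times> bool list set"

definition is_brel :: "brel \<Rightarrow> bool" where
  "is_brel R \<longleftrightarrow> fst R \<ge> 1 \<and> (\<forall>t \<in> snd R. length t = fst R)"

text \<open>A \<open>k\<close>-ary operation is a pair of \<open>k\<close> and a function that is only applied to lists of
  length \<open>k\<close>.\<close>

type_synonym bop = "nat \<times> (bool list \<Rightarrow> bool)"

definition apply_coordwise :: "bop \<Rightarrow> nat \<Rightarrow> bool list list \<Rightarrow> bool list" where
  "apply_coordwise f n ts = map (\<lambda>i. snd f (map (\<lambda>t. t ! i) ts)) [0..<n]"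

definition preserves :: "bop \<Rightarrow> brel \<Rightarrow> bool" where
  "preserves f R \<longleftrightarrow>
     (\<forall>ts. length ts = fst f \<and> set ts \<subseteq> snd R \<longrightarrow> apply_coordwise f (fst R) ts \<in> snd R)"

definition Inv :: "bop set \<Rightarrow> brel set" where
  "Inv F = {R. is_brel R \<and> (\<forall>f \<in> F. preserves f R)}"

definition and_op :: bop where
  "and_op = (2, \<lambda>as. as ! 0 \<and> as ! 1)"

text \<open>The constant 0 is nullary: a relation is preserved by it iff it contains the all-zero
  tuple. A unary constant would also admit the empty relations, which are not even
  primitive positive definable from relations containing the all-zero tuple.\<close>

definition zero_op :: bop where
  "zero_op = (0, \<lambda>_. False)"

definition IE0 :: "brel set" where
  "IE0 = Inv {and_op, zero_op}"

definition Eq_rel :: brel where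
  "Eq_rel = (2, {[a, b] | a b. a = b})"

text \<open>An atom is a relation applied to a tuple of variables. In a formula with free variables
  \<open>x\<^sub>1, \<dots>, x\<^sub>n\<close> and quantified variables \<open>y\<^sub>1, \<dots>, y\<^sub>m\<close>, the variable \<open>x\<^sub>i\<close> has index \<open>i - 1\<close>
  and \<open>y\<^sub>j\<close> has index \<open>n + j - 1\<close>; an assignment is the list of values \<open>xs @ ys\<close>.\<close>

type_synonym atom = "brel \<times> nat list"

definition wf_atom :: "brel set \<Rightarrow> nat \<Rightarrow> atom \<Rightarrow> bool" where
  "wf_atom \<Gamma> N A \<longleftrightarrow>
     fst A \<in> \<Gamma> \<union> {Eq_rel} \<and> length (snd A) = fst (fst A) \<and> (\<forall>v \<in> set (snd A). v < N)"

definition sat :: "bool list \<Rightarrow> atom list \<Rightarrow> bool" where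
  "sat as \<Phi> \<longleftrightarrow> (\<forall>A \<in> set \<Phi>. map (\<lambda>v. as ! v) (snd A) \<in> snd (fst A))"

definition upp_definition :: "brel set \<Rightarrow> nat \<Rightarrow> atom list \<Rightarrow> brel \<Rightarrow> bool" where
  "upp_definition \<Gamma> m \<Phi> R \<longleftrightarrow>
     (\<forall>A \<in> set \<Phi>. wf_atom \<Gamma> (fst R + m) A) \<and>
     snd R = {xs. length xs = fst R \<and> (\<exists>ys. length ys = m \<and> sat (xs @ ys) \<Phi>)} \<and>
     (\<forall>j < m. \<exists>f :: bool list \<Rightarrow> bool. \<forall>xs ys.
        length xs = fst R \<and> length ys = m \<and> sat (xs @ ys) \<Phi> \<longrightarrow> ys ! j = f xs)"

definition upp_closure :: "brel set \<Rightarrow> brel set" where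
  "upp_closure \<Gamma> = {R. is_brel R \<and> (\<exists>m \<Phi>. upp_definition \<Gamma> m \<Phi> R)}"

definition R_w :: brel where
  "R_w = (5, {[x1, x2, x3, x4, c0] | x1 x2 x3 x4 c0.
     (x1 \<longleftrightarrow> x2 \<and> x3) \<and> (x2 \<or> x3 \<longrightarrow> x4) \<and> c0 = False})"

end

theory Submission
  imports Defs
begin

text \<open>The separating relation is \<open>x\<^sub>1 \<longleftrightarrow> x\<^sub>2 \<and> x\<^sub>3\<close>. Suppose it had a upp-definition, and let \<open>s\<close>
  and \<open>t\<close> be the satisfying assignments over \<open>(0,1,0)\<close> and \<open>(0,0,1)\<close>. Both \<open>s \<and> t\<close> and the zero
  assignment satisfy the formula over \<open>(0,0,0)\<close>, so uniqueness forces \<open>s \<and> t = 0\<close>. For such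
  disjoint assignments \<open>s \<or> t\<close> is again satisfying: \<open>x\<^sub>1 \<longleftrightarrow> x\<^sub>2 \<and> x\<^sub>3\<close> in an atom of \<open>R\<^sub>w\<close> could only
  fail if \<open>x\<^sub>2\<close> is 1 in one of \<open>s, t\<close> and \<open>x\<^sub>3\<close> is 1 in the other, but then \<open>x\<^sub>4\<close> is 1 in both.
  Hence \<open>(0,1,1)\<close> would belong to the relation.\<close>

lemma Eq_rel_mem: "[a, b] \<in> snd Eq_rel \<longleftrightarrow> a = b"
  by (auto simp: Eq_rel_def)

lemma R_w_mem: "[a, b, c, d, e] \<in> snd R_w \<longleftrightarrow> (a \<longleftrightarrow> b \<and> c) \<and> (b \<or> c \<longrightarrow> d) \<and> \<not> e"
  by (simp add: R_w_def)

text \<open>Naming each variable of the tuple lets \<open>Eq_rel_mem\<close> and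
  \<open>R_w_mem\<close> turn satisfaction of an atom into propositional logic.\<close>

lemma wf_atom_R_w_cases:
  assumes "wf_atom {R_w} N A"
  obtains (Eq) u v where "A = (Eq_rel, [u, v])" "u < N" "v < N"
  | (R_w) a b c d e where "A = (R_w, [a, b, c, d, e])" "a < N" "b < N" "c < N" "d < N" "e < N"
proof -
  obtain R vs where A: "A = (R, vs)"
    by fastforce
  consider "R = Eq_rel" "length vs = 2" | "R = R_w" "length vs = 5"
    using assms A by (auto simp: wf_atom_def Eq_rel_def R_w_def)
  then show thesis
  proof cases
    case 1
    then obtain u v where "vs = [u, v]"
      by (auto simp: length_Suc_conv numeral_eq_Suc)
    then show ?thesis
      using Eq assms A 1 by (simp add: wf_atom_def)
  next
    case 2
    then obtain a b c d e where "vs = [a, b, c, d, e]"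
      by (auto simp: length_Suc_conv numeral_eq_Suc)
    then show ?thesis
      using R_w assms A 2 by (simp add: wf_atom_def)
  qed
qed

lemma sat_replicate_False:
  assumes "\<forall>A \<in> set \<Phi>. wf_atom {R_w} N A"
  shows "sat (replicate N False) \<Phi>"
  unfolding sat_def
proof
  fix A assume "A \<in> set \<Phi>"
  then have "wf_atom {R_w} N A"
    using assms by blast
  then show "map (\<lambda>v. replicate N False ! v) (snd A) \<in> snd (fst A)"
    by (cases rule: wf_atom_R_w_cases) (simp_all add: Eq_rel_mem R_w_mem)
qed

text \<open>Equality and \<open>R_w\<close> are both given by Horn clauses (for \<open>R_w\<close>:
  a implies b, a implies c, b and c imply a, b implies d, c implies d, not e), and the models of
  Horn clauses are closed under conjunction.\<close>

lemma sat_conj: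
  assumes "\<forall>A \<in> set \<Phi>. wf_atom {R_w} N A" "length s = N" "length t = N" "sat s \<Phi>" "sat t \<Phi>"
  shows "sat (map2 (\<and>) s t) \<Phi>"
  unfolding sat_def
proof
  fix A assume A: "A \<in> set \<Phi>"
  then have wf: "wf_atom {R_w} N A" and
    "map (\<lambda>v. s ! v) (snd A) \<in> snd (fst A)" "map (\<lambda>v. t ! v) (snd A) \<in> snd (fst A)"
    using assms by (auto simp: sat_def)
  with wf show "map (\<lambda>v. map2 (\<and>) s t ! v) (snd A) \<in> snd (fst A)"
    by (cases rule: wf_atom_R_w_cases) (auto simp: Eq_rel_mem R_w_mem assms(2,3))
qed

lemma sat_disj_of_disjoint:
  assumes "\<forall>A \<in> set \<Phi>. wf_atom {R_w} N A" "length s = N" "length t = N" "sat s \<Phi>" "sat t \<Phi>"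
    and disjoint: "\<And>v. v < N \<Longrightarrow> \<not> (s ! v \<and> t ! v)"
  shows "sat (map2 (\<or>) s t) \<Phi>"
  unfolding sat_def
proof
  fix A assume A: "A \<in> set \<Phi>"
  then have wf: "wf_atom {R_w} N A" and
    "map (\<lambda>v. s ! v) (snd A) \<in> snd (fst A)" "map (\<lambda>v. t ! v) (snd A) \<in> snd (fst A)"
    using assms by (auto simp: sat_def)
  with wf show "map (\<lambda>v. map2 (\<or>) s t ! v) (snd A) \<in> snd (fst A)"
  proof (cases rule: wf_atom_R_w_cases)
    case (R_w a b c d e)
    \<comment> \<open>Expanding (s_b or t_b) and (s_c or t_c) gives s_a, t_a and two mixed terms; a
      mixed term would make both \<open>s\<close> and \<open>t\<close> true at
      \<open>d\<close>.\<close>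
    then show ?thesis
      using disjoint[of d] \<open>map (\<lambda>v. s ! v) (snd A) \<in> _\<close> \<open>map (\<lambda>v. t ! v) (snd A) \<in> _\<close>
      by (auto simp: R_w_mem assms(2,3))
  qed (auto simp: Eq_rel_mem assms(2,3))
qed

lemma in_IE0_iff:
  "R \<in> IE0 \<longleftrightarrow> is_brel R \<and> replicate (fst R) False \<in> snd R \<and>
     (\<forall>s \<in> snd R. \<forall>t \<in> snd R. map2 (\<and>) s t \<in> snd R)"
proof (cases "is_brel R")
  case True
  \<comment> \<open>For arity 0 the only argument list is \<open>[]\<close>, so preservation is
    plain membership of the zero tuple.\<close>
  have zero: "preserves zero_op R \<longleftrightarrow> replicate (fst R) False \<in> snd R"
    by (simp add: preserves_def zero_op_def apply_coordwise_def map_replicate_const)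
  \<comment> \<open>\<open>map2\<close> stops at the shorter list, while
    \<open>apply_coordwise\<close> always yields \<open>fst R\<close> entries;
    \<open>is_brel\<close> makes the lengths agree.\<close>
  have coordwise: "apply_coordwise and_op (fst R) [s, t] = map2 (\<and>) s t"
    if "s \<in> snd R" "t \<in> snd R" for s t
    using that True
    by (auto simp: is_brel_def apply_coordwise_def and_op_def intro!: nth_equalityI)
  have two: "length ts = 2 \<longleftrightarrow> (\<exists>s t. ts = [s, t])" for ts :: "bool list list"
    by (auto simp: length_Suc_conv numeral_2_eq_2)
  have "preserves and_op R \<longleftrightarrow>
      (\<forall>s \<in> snd R. \<forall>t \<in> snd R. apply_coordwise and_op (fst R) [s, t] \<in> snd R)"
    unfolding preserves_def by (auto simp: two and_op_def[THEN arg_cong[of _ _ fst]])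
  then have conj: "preserves and_op R \<longleftrightarrow> (\<forall>s \<in> snd R. \<forall>t \<in> snd R. map2 (\<and>) s t \<in> snd R)"
    by (simp add: coordwise cong: ball_cong)
  show ?thesis
    using True zero conj by (auto simp: IE0_def Inv_def)
qed (simp add: IE0_def Inv_def)

text \<open>The satisfying assignments contain zero and are closed under conjunction, and both
  properties survive projection to the free variables.\<close>

lemma upp_closure_R_w_subset_IE0: "upp_closure {R_w} \<subseteq> IE0"
proof
  fix R assume "R \<in> upp_closure {R_w}"
  then obtain m \<Phi> where brel: "is_brel R" and wf: "\<forall>A \<in> set \<Phi>. wf_atom {R_w} (fst R + m) A"
    and R: "snd R = {xs. length xs = fst R \<and> (\<exists>ys. length ys = m \<and> sat (xs @ ys) \<Phi>)}"
    by (auto simp: upp_closure_def upp_definition_def)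
  have "replicate (fst R) False \<in> snd R"
    using sat_replicate_False[OF wf]
    by (auto simp: R replicate_add intro!: exI[of _ "replicate m False"])
  moreover have "map2 (\<and>) s t \<in> snd R" if st: "s \<in> snd R" "t \<in> snd R" for s t
  proof -
    obtain ys zs where "length s = fst R" "length t = fst R" "length ys = m" "length zs = m"
      "sat (s @ ys) \<Phi>" "sat (t @ zs) \<Phi>"
      using st unfolding R by blast
    with sat_conj[OF wf, of "s @ ys" "t @ zs"] show ?thesis
      by (auto simp: R intro!: exI[of _ "map2 (\<and>) ys zs"])
  qed
  ultimately show "R \<in> IE0"
    using brel by (simp add: in_IE0_iff)
qed

text \<open>This is the projection of \<open>R_w\<close> to its first three coordinates. Quantifying
  x4 away there is not unique: at x2 = x3 = 0 both values of x4 are allowed.\<close>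

definition conj_graph :: brel where
  "conj_graph = (3, {[b \<and> c, b, c] | b c. True})"

lemma conj_graph_in_IE0: "conj_graph \<in> IE0"
  by (auto simp: in_IE0_iff conj_graph_def is_brel_def numeral_3_eq_3)

lemma conj_graph_not_upp_definable: "conj_graph \<notin> upp_closure {R_w}"
proof
  assume "conj_graph \<in> upp_closure {R_w}"
  then obtain m \<Phi> where wf: "\<forall>A \<in> set \<Phi>. wf_atom {R_w} (3 + m) A"
    and rel: "snd conj_graph = {xs. length xs = 3 \<and> (\<exists>ys. length ys = m \<and> sat (xs @ ys) \<Phi>)}"
    and uniq: "\<forall>j < m. \<exists>f :: bool list \<Rightarrow> bool. \<forall>xs ys.
        length xs = 3 \<and> length ys = m \<and> sat (xs @ ys) \<Phi> \<longrightarrow> ys ! j = f xs"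
    by (auto simp: upp_closure_def upp_definition_def conj_graph_def)
  have "[False, True, False] \<in> snd conj_graph" "[False, False, True] \<in> snd conj_graph"
    by (auto simp: conj_graph_def)
  then obtain ys zs where ys: "length ys = m" "sat ([False, True, False] @ ys) \<Phi>"
    and zs: "length zs = m" "sat ([False, False, True] @ zs) \<Phi>"
    unfolding rel by blast
  let ?s = "[False, True, False] @ ys" and ?t = "[False, False, True] @ zs"
  have len: "length ?s = 3 + m" "length ?t = 3 + m"
    using ys zs by simp_all
  have zero: "sat ([False, False, False] @ replicate m False) \<Phi>"
    using sat_replicate_False[OF wf] by (simp add: replicate_add numeral_3_eq_3)
  have meet: "sat ([False, False, False] @ map2 (\<and>) ys zs) \<Phi>"
    using sat_conj[OF wf len ys(2) zs(2)] by simp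
  have ys_zs: "\<not> (ys ! j \<and> zs ! j)" if j: "j < m" for j
  proof -
    obtain f :: "bool list \<Rightarrow> bool" where f: "\<forall>xs us.
        length xs = 3 \<and> length us = m \<and> sat (xs @ us) \<Phi> \<longrightarrow> us ! j = f xs"
      using uniq j by presburger
    \<comment> \<open>Both assignments have free part (0,0,0), where \<open>f\<close> takes a single
      value.\<close>
    have "map2 (\<and>) ys zs ! j = f [False, False, False]"
      using f meet ys zs by simp
    moreover have "replicate m False ! j = f [False, False, False]"
      using f zero by simp
    ultimately have "map2 (\<and>) ys zs ! j = replicate m False ! j"
      by simp
    then show ?thesis
      using j ys zs by simp
  qed
  have "\<not> (?s ! v \<and> ?t ! v)" if "v < 3 + m" for v
  proof (cases "v < 3")
    case True
    then have "v = 0 \<or> v = 1 \<or> v = 2"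
      by auto
    then show ?thesis
      by auto
  next
    case False
    \<comment> \<open>Past the three free variables, position \<open>v\<close> holds entry
      \<open>v - 3\<close> of \<open>ys\<close> or \<open>zs\<close>.\<close>
    then show ?thesis
      using ys_zs[of "v - 3"] that by (simp add: nth_append nth_Cons' numeral_3_eq_3)
  qed
  then have "sat (map2 (\<or>) ?s ?t) \<Phi>"
    by (rule sat_disj_of_disjoint[OF wf len ys(2) zs(2)])
  then have "sat ([False, True, True] @ map2 (\<or>) ys zs) \<Phi>"
    by simp
  moreover have "length (map2 (\<or>) ys zs) = m"
    using ys zs by simp
  ultimately have "[False, True, True] \<in> snd conj_graph"
    unfolding rel by (intro CollectI conjI exI[of _ "map2 (\<or>) ys zs"]) simp_all
  then show False
    by (auto simp: conj_graph_def)
qed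

theorem theorem22: "upp_closure {R_w} \<subset> IE0"
  using upp_closure_R_w_subset_IE0 conj_graph_in_IE0 conj_graph_not_upp_definable by blast

end
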